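(* If $X$ is any Hausdorff space which satisfies $\mathrm{pd}(X)<\mathrm{d}(X)$, then $\Delta(X)<2^{2^{\mathrm{pd}(X)}}$.
   Context: For a topological space $X$ with topology $\tau_X$, a neighborhood assignment on $X$ is a map $U:X\to\tau_X$ with $x\in U(x)$ for all $x\in X$. A set $A\subseteq X$ pins down $U$ if $A\cap U(x)\neq\emptyset$ for all $x\in X$. The pinning down number $\mathrm{pd}(X)$ is the smallest cardinal $\kappa$ such that every neighborhood assignment on $X$ can be pinned down by a subset of $X$ of size $\kappa$. $\mathrm{d}(X)$ is the density of $X$ (the smallest cardinality of a dense subset). The dispersion character $\Delta(X)$ is the smallest cardinality of a non-empty open subset of $X$. *)

theory Defs
  imports "HOL-Analysis.Analysis"
begin

unbundle cardinal_syntax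

(* A cardinal is a relation k with Card_order k, taken up to =o. Cardinals k :: 'a rel are
   exactly those of subsets of the type 'a, so for properties satisfied by some cardinal at most
   |UNIV :: 'a set| the minimum over this type is the minimum over all cardinals.
   Finite cardinals are included. *)

definition is_least_cardinal :: "('a rel \<Rightarrow> bool) \<Rightarrow> 'a rel \<Rightarrow> bool" where
  "is_least_cardinal P \<kappa> \<longleftrightarrow>
     Card_order \<kappa> \<and> P \<kappa> \<and> (\<forall>\<mu>. Card_order \<mu> \<and> P \<mu> \<longrightarrow> \<kappa> \<le>o \<mu>)"

definition least_cardinal :: "('a rel \<Rightarrow> bool) \<Rightarrow> 'a rel" where
  "least_cardinal P = (SOME \<kappa>. is_least_cardinal P \<kappa>)"

definition neighborhood_assignment :: "'a topology \<Rightarrow> ('a \<Rightarrow> 'a set) \<Rightarrow> bool" where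
  "neighborhood_assignment X U \<longleftrightarrow> (\<forall>x\<in>topspace X. openin X (U x) \<and> x \<in> U x)"

definition pins_down :: "'a topology \<Rightarrow> 'a set \<Rightarrow> ('a \<Rightarrow> 'a set) \<Rightarrow> bool" where
  "pins_down X A U \<longleftrightarrow> (\<forall>x\<in>topspace X. A \<inter> U x \<noteq> {})"

definition pinning_down_number :: "'a topology \<Rightarrow> 'a rel" where
  "pinning_down_number X = least_cardinal (\<lambda>\<kappa>.
     \<forall>U. neighborhood_assignment X U \<longrightarrow> (\<exists>A\<subseteq>topspace X. |A| =o \<kappa> \<and> pins_down X A U))"

definition density_character :: "'a topology \<Rightarrow> 'a rel" where
  "density_character X = least_cardinal (\<lambda>\<kappa>.
     \<exists>D\<subseteq>topspace X. |D| =o \<kappa> \<and> X closure_of D = topspace X)"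

(* Unspecified for the empty space, which has no non-empty open set. *)
definition dispersion_character :: "'a topology \<Rightarrow> 'a rel" where
  "dispersion_character X = least_cardinal (\<lambda>\<kappa>.
     \<exists>W. openin X W \<and> W \<noteq> {} \<and> |W| =o \<kappa>)"

lemma is_least_cardinal_least_cardinal:
  assumes "Card_order \<mu>" "P \<mu>"
  shows "is_least_cardinal P (least_cardinal P)"
proof -
  have "\<exists>\<kappa>\<in>{\<nu>. Card_order \<nu> \<and> P \<nu>}. \<forall>\<nu>\<in>{\<nu>. Card_order \<nu> \<and> P \<nu>}. \<kappa> \<le>o \<nu>"
    using assms by (intro exists_minim_Card_order) auto
  then have "\<exists>\<kappa>. is_least_cardinal P \<kappa>"
    unfolding is_least_cardinal_def by blast
  then show ?thesis
    unfolding least_cardinal_def by (rule someI_ex)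
qed

lemma is_least_cardinal_pinning_down_number:
  "is_least_cardinal (\<lambda>\<kappa>. \<forall>U. neighborhood_assignment X U \<longrightarrow>
     (\<exists>A\<subseteq>topspace X. |A| =o \<kappa> \<and> pins_down X A U)) (pinning_down_number X)"
  unfolding pinning_down_number_def
  by (rule is_least_cardinal_least_cardinal[of "|topspace X|"])
    (auto simp: neighborhood_assignment_def pins_down_def intro!: exI[of _ "topspace X"] card_of_Card_order card_of_refl)

lemma is_least_cardinal_density_character:
  "is_least_cardinal (\<lambda>\<kappa>. \<exists>D\<subseteq>topspace X. |D| =o \<kappa> \<and> X closure_of D = topspace X)
     (density_character X)"
  unfolding density_character_def
  by (rule is_least_cardinal_least_cardinal[of "|topspace X|"])
    (auto intro!: exI[of _ "topspace X"] card_of_Card_order card_of_refl)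

lemma is_least_cardinal_dispersion_character:
  assumes "topspace X \<noteq> {}"
  shows "is_least_cardinal (\<lambda>\<kappa>. \<exists>W. openin X W \<and> W \<noteq> {} \<and> |W| =o \<kappa>)
     (dispersion_character X)"
  unfolding dispersion_character_def using assms
  by (intro is_least_cardinal_least_cardinal[of "|topspace X|"])
    (auto intro!: exI[of _ "topspace X"] card_of_Card_order card_of_refl)

end

(* Let \<kappa> = pd(X) and suppose that 2^(2^\<kappa>) \<le> \<Delta>(X). Any family of at most \<Delta>(X) nonempty open sets has
   distinct representatives, so it is part of a neighborhood assignment and is met by a set of size
   \<kappa>. Regular open sets U \<noteq> V are told apart by the nonempty one of U - cl V and V - cl U, so a set A
   of size \<kappa> meeting all these differences separates them by their traces on A: there are at most
   2^\<kappa> regular open sets. In a Hausdorff space they separate points, so |X| \<le> 2^(2^\<kappa>) and X has at most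
   2^(2^\<kappa>) subsets B of size \<kappa>. If \<kappa> < d(X), all the sets X - cl B are nonempty, so one A of size \<kappa>
   meets all of them, including X - cl A. *)
theory Submission
  imports Defs
begin

text \<open>Greedy choice by recursion along the cardinal well-order \<open>|I|\<close>. Before each
  index there are strictly fewer than \<open>|I|\<close> earlier ones, so the values already taken
  cannot exhaust \<open>F i\<close>.\<close>

lemma distinct_representatives:
  fixes F :: "'i \<Rightarrow> 'a set"
  assumes "\<And>i. i \<in> I \<Longrightarrow> |I| \<le>o |F i|"
  obtains g where "inj_on g I" "\<And>i. i \<in> I \<Longrightarrow> g i \<in> F i"
proof -
  let ?r = "|I|"
  have wo: "Well_order ?r"
    by (rule card_of_Well_order)
  have wf: "wf (?r - Id)"
    using wo unfolding well_order_on_def by blast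
  \<comment> \<open>The guard \<open>x \<in> I\<close> leaves values off \<open>I\<close> free, so
    the recursion can run over the whole type.\<close>
  let ?P = "\<lambda>f x r. x \<in> I \<longrightarrow> r \<in> F x \<and> (\<forall>z. (z, x) \<in> ?r - Id \<longrightarrow> r \<noteq> f z)"
  have "\<exists>f. \<forall>x. ?P f x (f x)"
  proof (rule dependent_wf_choice[OF wf])
    show "\<exists>r. ?P f x r" for x :: 'i and f :: "'i \<Rightarrow> 'a"
    proof (cases "x \<in> I")
      case True
      let ?S = "underS ?r x"
      have "|f ` ?S| <o |F x|"
        using card_of_image[of f ?S] card_of_underS[OF card_of_Card_order, of x I] assms[OF True] True
        by (metis Field_card_of ordLeq_ordLess_trans ordLess_ordLeq_trans)
      then have "\<not> F x \<subseteq> f ` ?S"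
        using card_of_mono1 not_ordLess_ordLeq by blast
      then obtain r where "r \<in> F x" "r \<notin> f ` ?S"
        by blast
      then show ?thesis
        unfolding underS_def by auto
    qed auto
  qed auto
  then obtain f where f: "\<And>x. ?P f x (f x)"
    by blast
  have "inj_on f I"
  proof (rule inj_onI, rule ccontr)
    fix x y
    assume xy: "x \<in> I" "y \<in> I" "f x = f y" "x \<noteq> y"
    have "(x, y) \<in> ?r \<or> (y, x) \<in> ?r"
      using wo xy unfolding well_order_on_def linear_order_on_def total_on_def
      by (simp add: Field_card_of)
    then show False
      using f[of x] f[of y] xy by (metis Diff_iff pair_in_Id_conv)
  qed
  then show ?thesis
    using f that by blast
qed

lemma pinning_set:
  assumes "neighborhood_assignment X U"
  obtains A where "A \<subseteq> topspace X" "|A| =o pinning_down_number X" "pins_down X A U"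
  using is_least_cardinal_pinning_down_number[of X] assms
  unfolding is_least_cardinal_def by blast

lemma Card_order_pinning_down_number: "Card_order (pinning_down_number X)"
  using is_least_cardinal_pinning_down_number unfolding is_least_cardinal_def by blast

lemma density_character_le:
  assumes "D \<subseteq> topspace X" "X closure_of D = topspace X"
  shows "density_character X \<le>o |D|"
  using is_least_cardinal_density_character[of X] assms card_of_Card_order card_of_refl
  unfolding is_least_cardinal_def by blast

lemma dispersion_character_le:
  assumes "openin X W" "W \<noteq> {}"
  shows "dispersion_character X \<le>o |W|"
proof -
  have "topspace X \<noteq> {}"
    using assms openin_subset by blast
  then show ?thesis
    using is_least_cardinal_dispersion_character[of X] assms card_of_Card_order card_of_refl
    unfolding is_least_cardinal_def by blast
qed

lemma pinning_set_family:
  assumes "\<And>i. i \<in> I \<Longrightarrow> openin X (F i)" "\<And>i. i \<in> I \<Longrightarrow> F i \<noteq> {}"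
    and "|I| \<le>o dispersion_character X"
  obtains A where "A \<subseteq> topspace X" "|A| =o pinning_down_number X"
    "\<And>i. i \<in> I \<Longrightarrow> A \<inter> F i \<noteq> {}"
proof -
  have "|I| \<le>o |F i|" if "i \<in> I" for i
    using dispersion_character_le[OF assms(1,2)] assms(3) that ordLeq_transitive by blast
  then obtain g where g: "inj_on g I" "\<And>i. i \<in> I \<Longrightarrow> g i \<in> F i"
    using distinct_representatives by blast
  \<comment> \<open>Injectivity of \<open>g\<close> recovers the index from its representative. All
    other points get the whole space, which excludes no nonempty pinning set.\<close>
  define U where "U x = (if x \<in> g ` I then F (inv_into I g x) else topspace X)" for x
  have Ug: "U (g i) = F i" if "i \<in> I" for i
    using that g by (simp add: U_def)
  have "neighborhood_assignment X U"
    unfolding neighborhood_assignment_def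
  proof
    fix x assume "x \<in> topspace X"
    then show "openin X (U x) \<and> x \<in> U x"
      using Ug assms(1) g(2) by (cases "x \<in> g ` I") (auto simp: U_def)
  qed
  then obtain A where A: "A \<subseteq> topspace X" "|A| =o pinning_down_number X" "pins_down X A U"
    by (rule pinning_set)
  have "A \<inter> F i \<noteq> {}" if "i \<in> I" for i
  proof -
    have "g i \<in> topspace X"
      using assms(1) g(2) openin_subset that by blast
    then show ?thesis
      using A(3) Ug that unfolding pins_down_def by metis
  qed
  with A that show ?thesis
    by blast
qed

lemma ctwo_cexp_eq_Pow:
  fixes \<kappa> :: "'k rel"
  assumes "|A| =o \<kappa>" "Card_order \<kappa>"
  shows "|Pow A| =o ctwo ^c \<kappa>"
proof -
  have "|Pow A| =o ctwo ^c |A|"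
    using card_of_Pow_Func[of A] by (simp add: cexp_def ctwo_def Field_card_of)
  also have "ctwo ^c |A| =o ctwo ^c \<kappa>"
    by (rule cexp_cong2[OF assms(1) Card_order_ctwo card_of_Card_order])
  finally show ?thesis .
qed

lemma Pow_le_ctwo_cexp:
  fixes \<kappa> :: "'k rel"
  assumes "|A| \<le>o \<kappa>" "Card_order \<kappa>"
  shows "|Pow A| \<le>o ctwo ^c \<kappa>"
proof -
  obtain f where "inj_on f A" "f ` A \<subseteq> Field \<kappa>"
    using assms by (metis card_of_Field_ordIso card_of_ordLeq ordIso_symmetric ordLeq_ordIso_trans)
  then have "|Pow A| \<le>o |Pow (Field \<kappa>)|"
    by (intro card_of_ordLeqI[of "image f"]) (auto intro: inj_on_image_Pow)
  then show ?thesis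
    using ctwo_cexp_eq_Pow[OF card_of_Field_ordIso] assms ordLeq_ordIso_trans by blast
qed

text \<open>The separation argument applies only to families of size at most \<theta>, which have
  few enough differences to pin. The gap between \<open>ctwo ^c pinning_down_number X\<close> and
  \<theta> then excludes larger families.\<close>

lemma card_regular_open_le:
  assumes inf: "infinite (Field \<theta>)" "Card_order \<theta>" "ctwo ^c pinning_down_number X <o \<theta>"
    and \<theta>: "\<theta> \<le>o dispersion_character X"
  shows "|{U. openin X U \<and> X interior_of (X closure_of U) = U}| \<le>o ctwo ^c pinning_down_number X"
    (is "|?R| \<le>o _")
proof -
  have small: "|\<U>| \<le>o ctwo ^c pinning_down_number X" if "\<U> \<subseteq> ?R" "|\<U>| \<le>o \<theta>" for \<U>
  proof -
    let ?F = "\<lambda>(U, V). U \<inter> (topspace X - X closure_of V)"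
    \<comment> \<open>Only nonempty differences can be pinned. As \<theta> is infinite, there are
      still at most \<theta> pairs.\<close>
    let ?I = "{p \<in> \<U> \<times> \<U>. ?F p \<noteq> {}}"
    have "|?I| \<le>o |\<U> \<times> \<U>|"
      by (rule card_of_mono1) auto
    also have "|\<U> \<times> \<U>| \<le>o \<theta>"
      using that inf by (intro card_of_Times_ordLeq_infinite_Field) auto
    also note \<theta>
    finally have "|?I| \<le>o dispersion_character X" .
    moreover have "openin X (?F p)" if "p \<in> ?I" for p
      using that \<open>\<U> \<subseteq> ?R\<close> by (auto intro!: openin_Int)
    ultimately obtain A where A: "A \<subseteq> topspace X" "|A| =o pinning_down_number X"
      and hit: "\<And>p. p \<in> ?I \<Longrightarrow> A \<inter> ?F p \<noteq> {}"
      using pinning_set_family[of ?I X ?F] by blast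
    \<comment> \<open>If the trace of \<open>U\<close> lies in \<open>V\<close>, then
      \<open>A\<close> misses U - cl V. This difference is therefore empty, so the open set
      \<open>U\<close> lies in int cl V = V.\<close>
    have sub: "U \<subseteq> V" if "U \<in> \<U>" "V \<in> \<U>" "U \<inter> A \<subseteq> V \<inter> A" for U V
    proof -
      have U: "openin X U" and "openin X V" and reg: "X interior_of (X closure_of V) = V"
        using \<open>\<U> \<subseteq> ?R\<close> that by auto
      then have V: "V \<subseteq> topspace X"
        by (simp add: openin_subset)
      have "?F (U, V) = {}"
      proof (rule ccontr)
        assume "?F (U, V) \<noteq> {}"
        then have "A \<inter> ?F (U, V) \<noteq> {}"
          using hit[of "(U, V)"] that by simp
        then show False
          using that(3) closure_of_subset[OF V] by auto
      qed
      then have "U \<subseteq> X closure_of V"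
        using openin_subset[OF U] by auto
      then show ?thesis
        using interior_of_maximal U reg by metis
    qed
    have "inj_on (\<lambda>U. U \<inter> A) \<U>"
      using sub by (intro inj_onI subset_antisym) blast+
    then have "|\<U>| \<le>o |Pow A|"
      by (rule card_of_ordLeqI) auto
    then show ?thesis
      using ctwo_cexp_eq_Pow[OF A(2) Card_order_pinning_down_number] ordLeq_ordIso_trans by blast
  qed
  show ?thesis
  proof (cases "|?R| \<le>o \<theta>")
    case True
    then show ?thesis
      using small by blast
  next
    case False
    \<comment> \<open>A subfamily of size exactly \<theta> would be subject to \<open>small\<close>,
      contradicting the strict bound below \<theta>.\<close>
    then have "\<theta> \<le>o |?R|"
      using inf(2) card_of_Well_order ordLeq_total unfolding card_order_on_def by blast
    then have "|Field \<theta>| \<le>o |?R|"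
      using inf(2) card_of_Field_ordIso ordIso_ordLeq_trans by blast
    then obtain h where "inj_on h (Field \<theta>)" "h ` Field \<theta> \<subseteq> ?R"
      unfolding card_of_ordLeq[symmetric] by blast
    moreover have "|Field \<theta>| =o |h ` Field \<theta>|"
      using inj_on_imp_bij_betw[OF \<open>inj_on h (Field \<theta>)\<close>] by (rule card_of_ordIsoI)
    then have h: "\<theta> =o |h ` Field \<theta>|"
      using ordIso_transitive[OF ordIso_symmetric[OF card_of_Field_ordIso[OF inf(2)]]] by blast
    ultimately have "|h ` Field \<theta>| \<le>o ctwo ^c pinning_down_number X"
      using small[OF _ ordIso_imp_ordLeq[OF ordIso_symmetric[OF h]]] by blast
    then have "\<theta> \<le>o ctwo ^c pinning_down_number X"
      by (rule ordIso_ordLeq_trans[OF h])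
    then show ?thesis
      using inf(3) not_ordLess_ordLeq by blast
  qed
qed

text \<open>A point is determined by the regular open sets containing it: for disjoint open
  neighborhoods U of x and V of y, the set int cl U is regular open, contains x and omits y, since V
  misses cl U.\<close>

lemma card_topspace_le:
  assumes "Hausdorff_space X"
    and "|{U. openin X U \<and> X interior_of (X closure_of U) = U}| \<le>o \<mu>" (is "|?R| \<le>o _")
    and "Card_order \<mu>"
  shows "|topspace X| \<le>o ctwo ^c \<mu>"
proof -
  let ?f = "\<lambda>x. {U \<in> ?R. x \<in> U}"
  have "inj_on ?f (topspace X)"
  proof (rule inj_onI, rule ccontr)
    fix x y
    assume xy: "x \<in> topspace X" "y \<in> topspace X" "?f x = ?f y" "x \<noteq> y"
    then obtain U V where UV: "openin X U" "openin X V" "x \<in> U" "y \<in> V" "disjnt U V"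
      using assms(1) unfolding Hausdorff_space_def by metis
    let ?W = "X interior_of (X closure_of U)"
    have "X interior_of (X closure_of ?W) = ?W"
    proof (rule subset_antisym)
      show "X interior_of (X closure_of ?W) \<subseteq> ?W"
        by (simp add: closure_of_minimal interior_of_mono interior_of_subset)
      show "?W \<subseteq> X interior_of (X closure_of ?W)"
        by (simp add: closure_of_subset interior_of_maximal interior_of_subset_topspace)
    qed
    then have "?W \<in> ?R"
      by simp
    moreover have "x \<in> ?W"
      using UV by (meson closure_of_subset interior_of_maximal openin_subset subsetD)
    moreover have "y \<notin> ?W"
    proof -
      have "y \<notin> X closure_of U"
        using UV unfolding in_closure_of disjnt_iff by blast
      then show ?thesis
        using interior_of_subset by fast
    qed
    ultimately show False
      using xy(3) by blast
  qed
  then have "|topspace X| \<le>o |Pow ?R|"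
    by (rule card_of_ordLeqI) auto
  also have "|Pow ?R| \<le>o ctwo ^c \<mu>"
    using assms(2,3) by (rule Pow_le_ctwo_cexp)
  finally show ?thesis .
qed

text \<open>Each such subset is the image of a function from \<open>Field \<kappa>\<close> to
  \<open>S\<close>.\<close>

lemma card_subsets_le_cexp:
  fixes \<kappa> :: "'k rel"
  assumes "Card_order \<kappa>"
  shows "|{A. A \<subseteq> S \<and> |A| =o \<kappa>}| \<le>o |S| ^c \<kappa>"
proof -
  have "{A. A \<subseteq> S \<and> |A| =o \<kappa>} \<subseteq> (\<lambda>f. f ` Field \<kappa>) ` Func (Field \<kappa>) S"
  proof
    fix A assume "A \<in> {A. A \<subseteq> S \<and> |A| =o \<kappa>}"
    then have A: "A \<subseteq> S" "|Field \<kappa>| =o |A|"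
      using assms by (auto intro: card_of_Field_ordIso ordIso_symmetric ordIso_transitive)
    then obtain f where "bij_betw f (Field \<kappa>) A"
      unfolding card_of_ordIso[symmetric] by blast
    then have "(\<lambda>x. if x \<in> Field \<kappa> then f x else undefined) \<in> Func (Field \<kappa>) S"
      "A = (\<lambda>x. if x \<in> Field \<kappa> then f x else undefined) ` Field \<kappa>"
      using A(1) by (auto simp: Func_def bij_betw_def)
    then show "A \<in> (\<lambda>f. f ` Field \<kappa>) ` Func (Field \<kappa>) S"
      by blast
  qed
  then have "|{A. A \<subseteq> S \<and> |A| =o \<kappa>}| \<le>o |Func (Field \<kappa>) S|"
    using surj_imp_ordLeq by blast
  then show ?thesis
    by (simp add: cexp_def Field_card_of)
qed

lemma infinite_pinning_down_number:
  assumes "Hausdorff_space X"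
    and "pinning_down_number X <o density_character X"
  shows "infinite (Field (pinning_down_number X))"
proof
  let ?\<kappa> = "pinning_down_number X"
  assume fin: "finite (Field ?\<kappa>)"
  have small: "|E| \<le>o ?\<kappa>" if E: "E \<subseteq> topspace X" "finite E" for E
  proof -
    have "\<forall>x y. \<exists>U V. x \<in> E \<and> y \<in> E \<and> x \<noteq> y \<longrightarrow>
      openin X U \<and> openin X V \<and> x \<in> U \<and> y \<in> V \<and> disjnt U V"
      using assms(1) E(1) unfolding Hausdorff_space_def by (meson subsetD)
    then obtain N M where NM: "\<And>x y. x \<in> E \<Longrightarrow> y \<in> E \<Longrightarrow> x \<noteq> y \<Longrightarrow>
      openin X (N x y) \<and> openin X (M x y) \<and> x \<in> N x y \<and> y \<in> M x y \<and> disjnt (N x y) (M x y)"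
      unfolding choice_iff by blast
    \<comment> \<open>The separating sets for (x, y) and (y, x) are chosen independently, hence both
      \<open>N x y\<close> and \<open>M y x\<close>. Intersecting with \<open>topspace X\<close>
      covers the case of a singleton \<open>E\<close>.\<close>
    define U where "U x = (if x \<in> E then topspace X \<inter> \<Inter>((\<lambda>y. N x y \<inter> M y x) ` (E - {x}))
      else topspace X)" for x
    have "openin X (U x) \<and> x \<in> U x" if "x \<in> topspace X" for x
    proof (cases "x \<in> E")
      case True
      have "openin X (topspace X \<inter> \<Inter>((\<lambda>y. N x y \<inter> M y x) ` (E - {x})))"
        using NM True E by (intro openin_Int_Inter) auto
      then show ?thesis
        using NM True that by (auto simp: U_def)
    qed (use that in \<open>auto simp: U_def\<close>)
    then obtain A where A: "A \<subseteq> topspace X" "|A| =o ?\<kappa>" "pins_down X A U"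
      using pinning_set[of X U] unfolding neighborhood_assignment_def by metis
    then have "\<exists>a. a \<in> A \<inter> U x" if "x \<in> E" for x
      using E that unfolding pins_down_def by blast
    then obtain a where a: "\<And>x. x \<in> E \<Longrightarrow> a x \<in> A \<inter> U x"
      by metis
    have "inj_on a E"
    proof (rule inj_onI, rule ccontr)
      fix x y assume xy: "x \<in> E" "y \<in> E" "a x = a y" "x \<noteq> y"
      then have "a x \<in> N x y" "a x \<in> M x y"
        using a[of x] a[of y] by (auto simp: U_def)
      then show False
        using NM xy unfolding disjnt_iff by blast
    qed
    then have "|E| \<le>o |A|"
      using a by (intro card_of_ordLeqI) auto
    then show ?thesis
      using A(2) ordLeq_ordIso_trans by blast
  qed
  have "card E \<le> card (Field ?\<kappa>)" if "E \<subseteq> topspace X" "finite E" for E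
  proof -
    have "|E| \<le>o |Field ?\<kappa>|"
      using small[OF that] Card_order_pinning_down_number
      by (metis card_of_Field_ordIso ordIso_symmetric ordLeq_ordIso_trans)
    then show ?thesis
      using fin by (metis card_inj_on_le card_of_ordLeq)
  qed
  then have "finite (topspace X)"
    by (meson finite_if_finite_subsets_card_bdd)
  then have "density_character X \<le>o ?\<kappa>"
    using small[of "topspace X"] density_character_le[of "topspace X" X] ordLeq_transitive by auto
  then show False
    using assms(2) not_ordLess_ordLeq by blast
qed

theorem theorem4p2:
  fixes X :: "'a topology"
  assumes "Hausdorff_space X"
    and "pinning_down_number X <o density_character X"
  shows "dispersion_character X <o ctwo ^c (ctwo ^c pinning_down_number X)"
proof (rule ccontr)
  let ?\<kappa> = "pinning_down_number X"
  let ?\<mu> = "ctwo ^c ?\<kappa>"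
  let ?\<theta> = "ctwo ^c ?\<mu>"
  have \<kappa>: "Cinfinite ?\<kappa>"
    using infinite_pinning_down_number[OF assms] Card_order_pinning_down_number
    unfolding cinfinite_def by blast
  have \<mu>: "Cinfinite ?\<mu>"
    by (rule Cinfinite_cexp[OF ordLeq_refl[OF Card_order_ctwo] \<kappa>])
  have \<theta>: "Cinfinite ?\<theta>"
    by (rule Cinfinite_cexp[OF ordLeq_refl[OF Card_order_ctwo] \<mu>])
  assume neg: "\<not> dispersion_character X <o ?\<theta>"
  \<comment> \<open>The dispersion character is specified only for nonempty spaces; an empty space
    would have density 0.\<close>
  have ne: "topspace X \<noteq> {}"
  proof
    assume "topspace X = {}"
    then have "density_character X \<le>o |{} :: 'a set|"
      using density_character_le[of "{}" X] by simp
    moreover have "|{} :: 'a set| \<le>o ?\<kappa>"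
      using \<kappa> by (simp add: card_of_empty1 card_order_on_def)
    ultimately show False
      using assms(2) not_ordLess_ordLeq ordLeq_transitive by blast
  qed
  have disp: "?\<theta> \<le>o dispersion_character X"
    using is_least_cardinal_dispersion_character[OF ne] neg \<theta>
    unfolding is_least_cardinal_def card_order_on_def by (simp add: not_ordLess_iff_ordLeq)
  \<comment> \<open>The negated conclusion allows \<open>?\<theta>\<close> as the infinite cardinal
    for counting regular open sets; it exceeds \<open>?\<mu>\<close> by Cantor's theorem.\<close>
  have "|topspace X| \<le>o ?\<theta>"
    using card_topspace_le[OF assms(1) card_regular_open_le[OF _ _ ordLess_ctwo_cexp disp]] \<theta> \<mu>
    unfolding cinfinite_def by blast
  let ?I = "{A. A \<subseteq> topspace X \<and> |A| =o ?\<kappa>}"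
  have "|?I| \<le>o |topspace X| ^c ?\<kappa>"
    by (rule card_subsets_le_cexp[OF Card_order_pinning_down_number])
  also have "|topspace X| ^c ?\<kappa> \<le>o ?\<theta> ^c ?\<kappa>"
    by (rule cexp_mono1[OF \<open>|topspace X| \<le>o ?\<theta>\<close> Card_order_pinning_down_number])
  \<comment> \<open>Here (2^\<mu>)^\<kappa> = 2^(\<mu> * \<kappa>) = 2^\<mu>, because \<kappa> \<le>
    \<mu> and \<mu> is infinite.\<close>
  also have "?\<theta> ^c ?\<kappa> =o ?\<theta>"
    by (rule cexp_cprod_ordLeq[OF Card_order_ctwo \<mu> Cinfinite_Cnotzero[OF \<kappa>]
        ordLess_imp_ordLeq[OF ordLess_ctwo_cexp[OF Card_order_pinning_down_number]]])
  also note disp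
  finally have I: "|?I| \<le>o dispersion_character X" .
  have "topspace X - X closure_of A \<noteq> {}" if "A \<in> ?I" for A
  proof
    assume "topspace X - X closure_of A = {}"
    then have dense: "X closure_of A = topspace X"
      using closure_of_subset_topspace[of X A] by blast
    have A: "A \<subseteq> topspace X" "|A| =o ?\<kappa>"
      using that by auto
    have "density_character X \<le>o ?\<kappa>"
      by (rule ordLeq_ordIso_trans[OF density_character_le[OF A(1) dense] A(2)])
    then show False
      using assms(2) not_ordLess_ordLeq by blast
  qed
  moreover have "openin X (topspace X - X closure_of A)" for A
    by auto
  ultimately obtain A where A: "A \<subseteq> topspace X" "|A| =o ?\<kappa>"
    and hit: "\<And>B. B \<in> ?I \<Longrightarrow> A \<inter> (topspace X - X closure_of B) \<noteq> {}"
    using pinning_set_family[OF _ _ I, of "\<lambda>A. topspace X - X closure_of A" thesis] by simp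
  \<comment> \<open>Diagonal step: the pinning set is itself one of the indices in
    \<open>?I\<close>.\<close>
  have "A \<inter> (topspace X - X closure_of A) \<noteq> {}"
    using hit A by simp
  then show False
    using closure_of_subset[OF A(1)] by blast
qed

end
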